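(* Let $R$ be an $n$-by-$n$ generalized matrix ring ($n>1$), and let $S=R^{\rm la}$ or $S=R^{\rm ua}$. If $\mathcal{D}(R)$ is strongly $\pi$-regular, then for each $0\neq y\in R$ either: (1) $y\in S$, in which case $y^p\in y^{p+1}S\subseteq y^{p+1}R$ for some positive integer $p$; or (2) $y\notin S$, in which case either $0\neq syE_{jj}\in S$ and $(syE_{jj})^m\in(syE_{jj})^{m+1}S\subseteq(syE_{jj})^{m+1}R$, or $0\neq E_{ii}yv\in S$ and $(E_{ii}yv)^k\in(E_{ii}yv)^{k+1}S\subseteq(E_{ii}yv)^{k+1}R$, for some $s,v,E_{ii},E_{jj}\in S$ and positive integers $k,m$.
   Context: All rings are associative with unity and modules are unital. An $n$-by-$n$ generalized matrix ring $R$ is a square array with rings $R_i$ on the diagonal and $(R_i,R_j)$-bimodules $M_{ij}$ in the $(i,j)$-positions ($i\neq j$, $M_{ii}=R_i$), together with $(R_i,R_k)$-bimodule homomorphisms $\theta_{ijk}:M_{ij}\otimes_{R_j}M_{jk}\to M_{ik}$, written $m_{ij}m_{jk}=\theta_{ijk}(m_{ij}\otimes m_{jk})$, satisfying $(m_{ij}m_{jk})m_{kl}=m_{ij}(m_{jk}m_{kl})$ for all indices; $\theta_{iii}$ is the multiplication of $R_i$, and $\theta_{ijj},\theta_{jjk}$ are the scalar multiplications. Addition is componentwise and multiplication is row-column matrix multiplication. $E_{ii}\in R$ is the matrix with $1\in R_i$ in the $(i,i)$-position and $0$ elsewhere. For subsets, $\underline{r}_A(B)=\{a\in A\mid Ba=0\}$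 and $\underline{\ell}_A(B)=\{a\in A\mid aB=0\}$. The lower annihilating subring $R^{\rm la}$ consists of all $[m_{ij}]\in R$ such that $m_{ij}\in\underline{r}_{M_{ij}}(M_{ji})\cap\underline{\ell}_{M_{ij}}(M_{ji})$ whenever $i>j$ (other entries arbitrary); the upper annihilating subring $R^{\rm ua}$ consists of all $[m_{ij}]\in R$ such that $m_{ij}\in\underline{r}_{M_{ij}}(M_{ji})\cap\underline{\ell}_{M_{ij}}(M_{ji})$ whenever $i<j$ (other entries arbitrary). $\mathcal{D}(R)=\{[r_{ij}]\in R\mid r_{ij}=0\text{ for all } i\neq j\}$. A ring $A$ is strongly $\pi$-regular if for each $x\in A$ there is a positive integer $q$ with $x^q\in x^{q+1}A$.
   Formalization: The formal theorem assumes explicitly that S (the lower or upper annihilating set) is a subring of R; for n ≥ 3 this does not follow from its definition, and part (1) fails without it. *)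

theory Defs
  imports "HOL-Algebra.Subrings"
begin

locale bimodule = R: ring R + S: ring S + M: abelian_group M
  for R :: "('a, 'r) ring_scheme" and S :: "('b, 's) ring_scheme" and M :: "('c, 'm) ring_scheme"
    and lsmult :: "'a \<Rightarrow> 'c \<Rightarrow> 'c" and rsmult :: "'c \<Rightarrow> 'b \<Rightarrow> 'c" +
  assumes lsmult_closed: "\<lbrakk>a \<in> carrier R; x \<in> carrier M\<rbrakk> \<Longrightarrow> lsmult a x \<in> carrier M"
    and rsmult_closed: "\<lbrakk>x \<in> carrier M; b \<in> carrier S\<rbrakk> \<Longrightarrow> rsmult x b \<in> carrier M"
    and lsmult_add: "\<lbrakk>a \<in> carrier R; x \<in> carrier M; y \<in> carrier M\<rbrakk> \<Longrightarrow>
      lsmult a (x \<oplus>\<^bsub>M\<^esub> y) = lsmult a x \<oplus>\<^bsub>M\<^esub> lsmult a y"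
    and add_lsmult: "\<lbrakk>a \<in> carrier R; a' \<in> carrier R; x \<in> carrier M\<rbrakk> \<Longrightarrow>
      lsmult (a \<oplus>\<^bsub>R\<^esub> a') x = lsmult a x \<oplus>\<^bsub>M\<^esub> lsmult a' x"
    and lsmult_assoc: "\<lbrakk>a \<in> carrier R; a' \<in> carrier R; x \<in> carrier M\<rbrakk> \<Longrightarrow>
      lsmult (a \<otimes>\<^bsub>R\<^esub> a') x = lsmult a (lsmult a' x)"
    and one_lsmult: "x \<in> carrier M \<Longrightarrow> lsmult \<one>\<^bsub>R\<^esub> x = x"
    and add_rsmult: "\<lbrakk>x \<in> carrier M; y \<in> carrier M; b \<in> carrier S\<rbrakk> \<Longrightarrow>
      rsmult (x \<oplus>\<^bsub>M\<^esub> y) b = rsmult x b \<oplus>\<^bsub>M\<^esub> rsmult y b"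
    and rsmult_add: "\<lbrakk>x \<in> carrier M; b \<in> carrier S; b' \<in> carrier S\<rbrakk> \<Longrightarrow>
      rsmult x (b \<oplus>\<^bsub>S\<^esub> b') = rsmult x b \<oplus>\<^bsub>M\<^esub> rsmult x b'"
    and rsmult_assoc: "\<lbrakk>x \<in> carrier M; b \<in> carrier S; b' \<in> carrier S\<rbrakk> \<Longrightarrow>
      rsmult x (b \<otimes>\<^bsub>S\<^esub> b') = rsmult (rsmult x b) b'"
    and rsmult_one: "x \<in> carrier M \<Longrightarrow> rsmult x \<one>\<^bsub>S\<^esub> = x"
    and lsmult_rsmult: "\<lbrakk>a \<in> carrier R; x \<in> carrier M; b \<in> carrier S\<rbrakk> \<Longrightarrow>
      rsmult (lsmult a x) b = lsmult a (rsmult x b)"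

text \<open>
  An \<open>(R,T)\<close>-bimodule homomorphism \<open>M \<otimes>\<^sub>S N \<rightarrow> P\<close>, for an \<open>(R,S)\<close>-bimodule \<open>M\<close>, an
  \<open>(S,T)\<close>-bimodule \<open>N\<close> and an \<open>(R,T)\<close>-bimodule \<open>P\<close>. The noncommutative tensor product is rendered by
  its universal property: such homomorphisms are the biadditive, \<open>S\<close>-balanced maps \<open>f\<close> on pairs,
  \<open>f x y\<close> being the image of \<open>x \<otimes> y\<close>, that are \<open>R\<close>-linear on the left and \<open>T\<close>-linear on the right.
\<close>

locale tensor_bimodule_hom =
  M: bimodule R S M lM rM + N: bimodule S T N lN rN + P: bimodule R T P lP rP
  for R :: "('a, 'r) ring_scheme" and S :: "('b, 's) ring_scheme" and T :: "('c, 't) ring_scheme"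
    and M :: "('x, 'm) ring_scheme" and lM rM
    and N :: "('y, 'n) ring_scheme" and lN rN
    and P :: "('z, 'p) ring_scheme" and lP rP
    and f :: "'x \<Rightarrow> 'y \<Rightarrow> 'z" +
  assumes hom_closed: "\<lbrakk>x \<in> carrier M; y \<in> carrier N\<rbrakk> \<Longrightarrow> f x y \<in> carrier P"
    and hom_add_left: "\<lbrakk>x \<in> carrier M; x' \<in> carrier M; y \<in> carrier N\<rbrakk> \<Longrightarrow>
      f (x \<oplus>\<^bsub>M\<^esub> x') y = f x y \<oplus>\<^bsub>P\<^esub> f x' y"
    and hom_add_right: "\<lbrakk>x \<in> carrier M; y \<in> carrier N; y' \<in> carrier N\<rbrakk> \<Longrightarrow>
      f x (y \<oplus>\<^bsub>N\<^esub> y') = f x y \<oplus>\<^bsub>P\<^esub> f x y'"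
    and hom_balanced: "\<lbrakk>x \<in> carrier M; b \<in> carrier S; y \<in> carrier N\<rbrakk> \<Longrightarrow>
      f (rM x b) y = f x (lN b y)"
    and hom_left_linear: "\<lbrakk>a \<in> carrier R; x \<in> carrier M; y \<in> carrier N\<rbrakk> \<Longrightarrow>
      f (lM a x) y = lP a (f x y)"
    and hom_right_linear: "\<lbrakk>x \<in> carrier M; y \<in> carrier N; c \<in> carrier T\<rbrakk> \<Longrightarrow>
      f x (rN y c) = rP (f x y) c"

text \<open>
  The diagonal ring \<open>R\<^sub>i\<close> is \<open>M i i\<close>. For \<open>i \<noteq> j\<close> only the additive part of the record \<open>M i j\<close> is
  meaningful; its fields \<open>mult\<close> and \<open>one\<close> are never used. \<open>\<theta> i j k x y\<close> is the image of \<open>x \<otimes> y\<close> in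
  \<open>M i k\<close>, and the scalar multiplications of \<open>M i j\<close> are \<open>\<theta> i i j\<close> and \<open>\<theta> i j j\<close>. That all \<open>M i j\<close>
  have elements in one type is no restriction, since only carriers matter.
\<close>

locale generalized_matrix_ring =
  fixes n :: nat and M :: "nat \<Rightarrow> nat \<Rightarrow> 'a ring" and \<theta> :: "nat \<Rightarrow> nat \<Rightarrow> nat \<Rightarrow> 'a \<Rightarrow> 'a \<Rightarrow> 'a"
  assumes diag_ring: "i \<in> {1..n} \<Longrightarrow> ring (M i i)"
    and bimodule: "\<lbrakk>i \<in> {1..n}; j \<in> {1..n}; i \<noteq> j\<rbrakk> \<Longrightarrow>
      bimodule (M i i) (M j j) (M i j) (\<theta> i i j) (\<theta> i j j)"
    and theta_diag: "\<lbrakk>i \<in> {1..n}; x \<in> carrier (M i i); y \<in> carrier (M i i)\<rbrakk> \<Longrightarrow>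
      \<theta> i i i x y = x \<otimes>\<^bsub>M i i\<^esub> y"
    and theta_hom: "\<lbrakk>i \<in> {1..n}; j \<in> {1..n}; k \<in> {1..n}\<rbrakk> \<Longrightarrow>
      tensor_bimodule_hom (M i i) (M j j) (M k k)
        (M i j) (\<theta> i i j) (\<theta> i j j) (M j k) (\<theta> j j k) (\<theta> j k k) (M i k) (\<theta> i i k) (\<theta> i k k)
        (\<theta> i j k)"
    and theta_assoc: "\<lbrakk>i \<in> {1..n}; j \<in> {1..n}; k \<in> {1..n}; l \<in> {1..n};
      x \<in> carrier (M i j); y \<in> carrier (M j k); z \<in> carrier (M k l)\<rbrakk> \<Longrightarrow>
      \<theta> i k l (\<theta> i j k x y) z = \<theta> i j l x (\<theta> j k l y z)"

text \<open>The \<open>(i,j)\<close>-entry of a matrix \<open>A\<close> is \<open>A (i, j)\<close>, with \<open>1 \<le> i, j \<le> n\<close>.\<close>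

definition gm_ring ::
    "nat \<Rightarrow> (nat \<Rightarrow> nat \<Rightarrow> 'a ring) \<Rightarrow> (nat \<Rightarrow> nat \<Rightarrow> nat \<Rightarrow> 'a \<Rightarrow> 'a \<Rightarrow> 'a) \<Rightarrow> (nat \<times> nat \<Rightarrow> 'a) ring"
  where "gm_ring n M \<theta> =
   \<lparr>carrier = PiE ({1..n} \<times> {1..n}) (\<lambda>(i, j). carrier (M i j)),
    mult = (\<lambda>A B. \<lambda>(i, k) \<in> {1..n} \<times> {1..n}. \<Oplus>\<^bsub>M i k\<^esub> j \<in> {1..n}. \<theta> i j k (A (i, j)) (B (j, k))),
    one = (\<lambda>(i, j) \<in> {1..n} \<times> {1..n}. if i = j then \<one>\<^bsub>M i i\<^esub> else \<zero>\<^bsub>M i j\<^esub>),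
    zero = (\<lambda>(i, j) \<in> {1..n} \<times> {1..n}. \<zero>\<^bsub>M i j\<^esub>),
    add = (\<lambda>A B. \<lambda>(i, j) \<in> {1..n} \<times> {1..n}. A (i, j) \<oplus>\<^bsub>M i j\<^esub> B (i, j))\<rparr>"

definition diag_unit :: "nat \<Rightarrow> (nat \<Rightarrow> nat \<Rightarrow> 'a ring) \<Rightarrow> nat \<Rightarrow> nat \<times> nat \<Rightarrow> 'a"
  where "diag_unit n M i =
    (\<lambda>(k, l) \<in> {1..n} \<times> {1..n}. if k = i \<and> l = i then \<one>\<^bsub>M i i\<^esub> else \<zero>\<^bsub>M k l\<^esub>)"

definition diag_matrices ::
    "nat \<Rightarrow> (nat \<Rightarrow> nat \<Rightarrow> 'a ring) \<Rightarrow> (nat \<Rightarrow> nat \<Rightarrow> nat \<Rightarrow> 'a \<Rightarrow> 'a \<Rightarrow> 'a) \<Rightarrow> (nat \<times> nat \<Rightarrow> 'a) set"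
  where "diag_matrices n M \<theta> =
    {A \<in> carrier (gm_ring n M \<theta>). \<forall>i\<in>{1..n}. \<forall>j\<in>{1..n}. i \<noteq> j \<longrightarrow> A (i, j) = \<zero>\<^bsub>M i j\<^esub>}"

text \<open>\<open>r\<close>- and \<open>\<ell>\<close>-annihilators in \<open>M i j\<close> of \<open>M j i\<close>; the products lie in \<open>R\<^sub>j\<close> and \<open>R\<^sub>i\<close>.\<close>

definition right_ann ::
    "(nat \<Rightarrow> nat \<Rightarrow> 'a ring) \<Rightarrow> (nat \<Rightarrow> nat \<Rightarrow> nat \<Rightarrow> 'a \<Rightarrow> 'a \<Rightarrow> 'a) \<Rightarrow> nat \<Rightarrow> nat \<Rightarrow> 'a set"
  where "right_ann M \<theta> i j =
    {a \<in> carrier (M i j). \<forall>b \<in> carrier (M j i). \<theta> j i j b a = \<zero>\<^bsub>M j j\<^esub>}"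

definition left_ann ::
    "(nat \<Rightarrow> nat \<Rightarrow> 'a ring) \<Rightarrow> (nat \<Rightarrow> nat \<Rightarrow> nat \<Rightarrow> 'a \<Rightarrow> 'a \<Rightarrow> 'a) \<Rightarrow> nat \<Rightarrow> nat \<Rightarrow> 'a set"
  where "left_ann M \<theta> i j =
    {a \<in> carrier (M i j). \<forall>b \<in> carrier (M j i). \<theta> i j i a b = \<zero>\<^bsub>M i i\<^esub>}"

text \<open>
  For \<open>n = 2\<close> the two sets below are always subrings of the generalized matrix ring. For \<open>n \<ge> 3\<close> they
  need not be closed under multiplication. Example: let \<open>A\<close> be the path algebra over a field of
  the cyclic quiver with arrows \<open>a\<close> from 1 to 2, \<open>b\<close> from 2 to 3 and \<open>c\<close> from 3 to 1 (paths composed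
  from left to right), modulo \<open>abc = cab = 0\<close>, and \<open>M i j = e\<^sub>i A e\<^sub>j\<close>. Then \<open>b\<close> and \<open>c\<close> lie in the lower
  annihilating set but \<open>bc\<close>, whose product with \<open>a \<in> M 1 2\<close> is \<open>bca \<noteq> 0\<close>, does not.
  That the set is a subring is therefore a separate hypothesis wherever it is needed.
\<close>

definition lower_annihilating ::
    "nat \<Rightarrow> (nat \<Rightarrow> nat \<Rightarrow> 'a ring) \<Rightarrow> (nat \<Rightarrow> nat \<Rightarrow> nat \<Rightarrow> 'a \<Rightarrow> 'a \<Rightarrow> 'a) \<Rightarrow> (nat \<times> nat \<Rightarrow> 'a) set"
  where "lower_annihilating n M \<theta> =
    {A \<in> carrier (gm_ring n M \<theta>). \<forall>i\<in>{1..n}. \<forall>j\<in>{1..n}. i > j \<longrightarrow>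
      A (i, j) \<in> right_ann M \<theta> i j \<inter> left_ann M \<theta> i j}"

definition upper_annihilating ::
    "nat \<Rightarrow> (nat \<Rightarrow> nat \<Rightarrow> 'a ring) \<Rightarrow> (nat \<Rightarrow> nat \<Rightarrow> nat \<Rightarrow> 'a \<Rightarrow> 'a \<Rightarrow> 'a) \<Rightarrow> (nat \<times> nat \<Rightarrow> 'a) set"
  where "upper_annihilating n M \<theta> =
    {A \<in> carrier (gm_ring n M \<theta>). \<forall>i\<in>{1..n}. \<forall>j\<in>{1..n}. i < j \<longrightarrow>
      A (i, j) \<in> right_ann M \<theta> i j \<inter> left_ann M \<theta> i j}"

definition strongly_pi_regular :: "('a, 'm) ring_scheme \<Rightarrow> bool"
  where "strongly_pi_regular A \<longleftrightarrow>
    (\<forall>x \<in> carrier A. \<exists>q::nat. q > 0 \<and> x [^]\<^bsub>A\<^esub> q \<in> x [^]\<^bsub>A\<^esub> (q + 1) <#\<^bsub>A\<^esub> carrier A)"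

end

theory Submission
  imports Defs
begin

text \<open>
  The lower and the upper case differ only in which of the positions \<open>(i,j)\<close>, \<open>(j,i)\<close> carries the
  annihilator condition. Both are instances of \<open>annihilating P\<close>, where \<open>P\<close> is a relation on indices
  that holds in exactly one direction for each pair of distinct indices.

  Let \<open>S\<close> be such a subring. If \<open>A, B \<in> S\<close> and \<open>i \<noteq> j\<close>, then one of the entries
  \<open>A (i, j)\<close>, \<open>B (j, i)\<close> is an annihilator, so their product vanishes
  (\<open>annihilating_opposite_entries\<close>). This has two consequences. Diagonal entries multiply as if the
  matrices were diagonal (\<open>annihilating_diag_mult\<close>), so taking the diagonal is a ring homomorphism
  from \<open>S\<close> onto the diagonal matrices. And the kernel of this homomorphism is nil: in the expansion
  of the \<open>n\<close>-th power of a matrix with zero diagonal, each term is a product along a walk that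
  visits some index \<open>i\<close> twice. Between the two visits there is a step to some \<open>j \<noteq> i\<close> followed by
  a return from \<open>j\<close> to \<open>i\<close>, and the corresponding product is one of opposite entries of
  elements of \<open>S\<close>, hence zero
  (\<open>nilpotent_of_corners\<close>, \<open>annihilating_nilpotent\<close>).

  Strong \<open>\<pi>\<close>-regularity lifts along such a homomorphism. Let \<open>y \<in> S\<close> have diagonal part \<open>d\<close>. Then
  \<open>d\<^sup>q \<in> d\<^sup>m D\<close> for some \<open>q\<close> and for \<open>m\<close> as large as desired, hence \<open>y\<^sup>q = y\<^sup>m b + e\<close> with
  \<open>b \<in> S\<close> and \<open>e \<in> S\<close> of zero diagonal. The right ideal \<open>y\<^sup>m S\<close> is also stable
  under left multiplication by \<open>y\<close>, so modulo it the powers of \<open>y\<^sup>q\<close> and of \<open>e\<close> agree. As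
  \<open>e\<^sup>n = 0\<close>, this puts \<open>y\<^sup>n\<^sup>q\<close> into \<open>y\<^sup>m S\<close>, and it remains to choose \<open>m = n q + 1\<close>
  (\<open>pow_in_coset_of_nilpotent\<close>, \<open>annihilating_strongly_pi_regular\<close>).

  If \<open>y \<notin> S\<close>, then some entry \<open>y (i, j)\<close> with \<open>P i j\<close> has a nonzero product with some
  \<open>b \<in> M j i\<close>, on the left or on the right. The matrix \<open>s\<close> with the single entry \<open>b\<close> in position
  \<open>(j, i)\<close> belongs to \<open>S\<close>, because that position is unconstrained, and one of \<open>s y E\<^sub>j\<^sub>j\<close> and
  \<open>E\<^sub>i\<^sub>i y s\<close> is a nonzero diagonal matrix (\<open>non_annihilating_diagonal_corner\<close>). Being diagonal, it
  lies in \<open>S\<close>, and the first part applies to it.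
\<close>

section \<open>Finite sums in abelian groups\<close>

lemma additive_finsum:
  assumes G: "abelian_group G" and H: "abelian_group H"
    and closed: "\<And>x. x \<in> carrier G \<Longrightarrow> h x \<in> carrier H"
    and add: "\<And>x y. \<lbrakk>x \<in> carrier G; y \<in> carrier G\<rbrakk> \<Longrightarrow> h (x \<oplus>\<^bsub>G\<^esub> y) = h x \<oplus>\<^bsub>H\<^esub> h y"
    and fin: "finite A" and f: "f \<in> A \<rightarrow> carrier G"
  shows "h (finsum G f A) = finsum H (\<lambda>a. h (f a)) A"
proof -
  interpret G: abelian_group G by (rule G)
  interpret H: abelian_group H by (rule H)
  have "h \<zero>\<^bsub>G\<^esub> \<oplus>\<^bsub>H\<^esub> h \<zero>\<^bsub>G\<^esub> = h \<zero>\<^bsub>G\<^esub>"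
    using add[of "\<zero>\<^bsub>G\<^esub>" "\<zero>\<^bsub>G\<^esub>"] by simp
  then have zero: "h \<zero>\<^bsub>G\<^esub> = \<zero>\<^bsub>H\<^esub>"
    using closed[OF G.zero_closed] by (metis H.add.r_cancel_one')
  show ?thesis
    using fin f
  proof (induction A rule: finite_induct)
    case (insert a A)
    then show ?case
      by (simp add: add closed Pi_iff)
  qed (simp add: zero)
qed

lemma (in abelian_monoid) finsum_swap:
  assumes "finite A" "finite B"
    and "\<And>a b. \<lbrakk>a \<in> A; b \<in> B\<rbrakk> \<Longrightarrow> f a b \<in> carrier G"
  shows "(\<Oplus>a\<in>A. \<Oplus>b\<in>B. f a b) = (\<Oplus>b\<in>B. \<Oplus>a\<in>A. f a b)"
  using assms(1,3)
proof (induction A rule: finite_induct)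
  case empty
  then show ?case by (simp add: finsum_zero)
next
  case (insert a A)
  have "(\<Oplus>b\<in>B. \<Oplus>a'\<in>insert a A. f a' b) = (\<Oplus>b\<in>B. f a b \<oplus> (\<Oplus>a'\<in>A. f a' b))"
    using insert by (intro finsum_cong') (auto intro!: finsum_insert finsum_closed a_closed)
  also have "\<dots> = (\<Oplus>b\<in>B. f a b) \<oplus> (\<Oplus>b\<in>B. \<Oplus>a'\<in>A. f a' b)"
    using insert by (intro finsum_addf) (auto intro!: finsum_closed)
  finally show ?case
    using insert by (subst finsum_insert) (auto intro!: finsum_closed)
qed

lemma (in abelian_monoid) finsum_single:
  assumes "finite A" "i \<in> A" "f i \<in> carrier G"
    and "\<And>j. \<lbrakk>j \<in> A; j \<noteq> i\<rbrakk> \<Longrightarrow> f j = \<zero>"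
  shows "finsum G f A = f i"
proof -
  have f: "f \<in> A \<rightarrow> carrier G"
  proof
    fix j assume "j \<in> A"
    then show "f j \<in> carrier G"
      using assms(3,4) by (cases "j = i") simp_all
  qed
  have "finsum G f A = (\<Oplus>j\<in>A. if i = j then f j else \<zero>)"
  proof (rule finsum_cong')
    show "(\<lambda>j. if i = j then f j else \<zero>) \<in> A \<rightarrow> carrier G"
      using f by (simp add: Pi_iff)
  qed (use assms(4) in auto)
  also have "\<dots> = f i"
    by (rule finsum_singleton[OF assms(2,1) f])
  finally show ?thesis .
qed

section \<open>Nilpotence and strong regularity\<close>

text \<open>
  Expanding \<open>e\<^sup>k\<close> along \<open>1 = \<Sum> E\<^sub>i\<close> gives products along walks in \<open>I\<close>, and a walk with \<open>|I|\<close>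
  steps must repeat an index. Summing over walks is avoided by an induction on the number of
  indices that have not been visited yet.
\<close>

lemma (in ring) nilpotent_of_corners:
  assumes S: "subring S R" and fin: "finite I"
    and E: "\<And>i. i \<in> I \<Longrightarrow> E i \<in> S" and one: "finsum R E I = \<one>"
    and e: "e \<in> S"
    and corner: "\<And>i t. \<lbrakk>i \<in> I; t \<in> S\<rbrakk> \<Longrightarrow> E i \<otimes> (e \<otimes> t) \<otimes> E i = \<zero>"
  shows "e [^] card I = \<zero>"
proof -
  note sub = subringE[OF S]
  have cS [simp]: "s \<in> carrier R" if "s \<in> S" for s
    using sub(1) that by auto
  have EI: "E i \<in> carrier R" if "i \<in> I" for i
    using E that by auto
  \<comment> \<open>\<open>z\<close> is the product along an initial part of a walk and \<open>A\<close> the set of indices visited by it: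
    a return to \<open>A\<close> gives zero.\<close>
  have "z \<otimes> e [^] card (I - A) = \<zero>"
    if "z \<in> S" "A \<subseteq> I" "\<forall>i\<in>A. \<forall>t\<in>S. z \<otimes> t \<otimes> E i = \<zero>" for z A
    using that
  proof (induction "card (I - A)" arbitrary: A z)
    case 0
    then have "A = I" using fin by auto
    then have zE: "z \<otimes> E i = \<zero>" if "i \<in> I" for i
      using "0.prems" that sub(3) by (metis cS r_one)
    have "z = z \<otimes> finsum R E I"
      using one "0.prems" by simp
    also have "\<dots> = (\<Oplus>i\<in>I. z \<otimes> E i)"
      using fin EI "0.prems" by (intro finsum_rdistr) auto
    also have "\<dots> = \<zero>"
      using zE by (simp add: add.finprod_one_eqI)
    finally show ?case using fin \<open>A = I\<close> by simp
  next
    case (Suc k)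
    have zc: "z \<in> carrier R" and ec: "e \<in> carrier R" using Suc.prems e by auto
    have step: "z \<otimes> E j \<otimes> e [^] Suc k = \<zero>" if j: "j \<in> I" for j
    proof (cases "j \<in> A")
      case True
      then have "z \<otimes> \<one> \<otimes> E j = \<zero>" using Suc.prems sub(3) by blast
      then show ?thesis using zc ec by simp
    next
      case False
      have Ej: "E j \<in> S" using E j .
      have "k = card (I - insert j A)"
        using Suc(2) False j fin by (metis Diff_insert card_Diff_singleton diff_Suc_1 DiffI)
      moreover have "z \<otimes> E j \<otimes> e \<in> S"
        using Suc.prems Ej e sub(6) by simp
      moreover have "z \<otimes> E j \<otimes> e \<otimes> t \<otimes> E i = \<zero>" if i: "i \<in> insert j A" and t: "t \<in> S" for i t
      proof (cases "i = j")
        case True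
        have "z \<otimes> E j \<otimes> e \<otimes> t \<otimes> E j = z \<otimes> (E j \<otimes> (e \<otimes> t) \<otimes> E j)"
          using zc Ej ec t by (simp add: m_assoc)
        then show ?thesis using True corner[OF j t] zc by simp
      next
        case False
        have "z \<otimes> E j \<otimes> e \<otimes> t \<otimes> E i = z \<otimes> (E j \<otimes> e \<otimes> t) \<otimes> E i"
          using zc Ej ec t by (simp add: m_assoc)
        moreover have "E j \<otimes> e \<otimes> t \<in> S"
          using Ej e t sub(6) by simp
        ultimately show ?thesis using Suc.prems False i by simp
      qed
      ultimately have "z \<otimes> E j \<otimes> e \<otimes> e [^] card (I - insert j A) = \<zero>"
        using Suc.prems(2) j by (intro Suc.hyps(1)) auto
      then have "z \<otimes> E j \<otimes> e \<otimes> e [^] k = \<zero>"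
        using \<open>k = _\<close> by simp
      then show ?thesis
        using zc Ej ec nat_pow_Suc2[OF ec, of k] by (simp add: m_assoc)
    qed
    have "z \<otimes> e [^] Suc k = z \<otimes> finsum R E I \<otimes> e [^] Suc k"
      using one zc by simp
    also have "z \<otimes> finsum R E I = (\<Oplus>i\<in>I. z \<otimes> E i)"
      using fin EI zc by (intro finsum_rdistr) auto
    also have "(\<Oplus>i\<in>I. z \<otimes> E i) \<otimes> e [^] Suc k = (\<Oplus>i\<in>I. z \<otimes> E i \<otimes> e [^] Suc k)"
      using fin EI zc ec by (intro finsum_ldistr) auto
    also have "\<dots> = \<zero>"
      using step by (simp add: add.finprod_one_eqI)
    finally show ?case using Suc(2) by simp
  qed
  from this[of \<one> "{}"] show ?thesis
    using sub(3) e by simp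
qed

text \<open>
  Put \<open>u = x\<^sup>q\<close>. By induction \<open>u\<^sup>r = x\<^sup>m c + e\<^sup>r\<close> for some \<open>c \<in> S\<close>: multiplying by \<open>u\<close> from the
  left turns \<open>x\<^sup>m c\<close> into \<open>x\<^sup>m (u c)\<close>, and \<open>u e\<^sup>r = x\<^sup>m (b e\<^sup>r) + e\<^sup>r\<^sup>+\<^sup>1\<close> by the hypothesis on \<open>u\<close>.
\<close>

lemma (in ring) pow_in_coset_of_nilpotent:
  assumes S: "subring S R" and x: "x \<in> S" and b: "b \<in> S" and e: "e \<in> S"
    and eq: "x [^] (q::nat) = x [^] (m::nat) \<otimes> b \<oplus> e" and nil: "e [^] (k::nat) = \<zero>"
  shows "x [^] (k * q) \<in> x [^] m <# S"
proof -
  note sub = subringE[OF S]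
  have c: "x \<in> carrier R" "b \<in> carrier R" "e \<in> carrier R"
    using sub(1) x b e by auto
  have pow: "s [^] (r::nat) \<in> S" if "s \<in> S" for s r
    using that sub by (induction r) auto
  have "\<exists>c\<in>S. x [^] (r * q) = x [^] m \<otimes> c \<oplus> e [^] r" for r
  proof (induction r)
    case 0
    show ?case using c sub(2) by (intro bexI[of _ \<zero>]) simp_all
  next
    case (Suc r)
    then obtain d where d: "d \<in> S" "x [^] (r * q) = x [^] m \<otimes> d \<oplus> e [^] r" by auto
    have dc: "d \<in> carrier R" using d sub(1) by auto
    have "x [^] (Suc r * q) = x [^] q \<otimes> x [^] (r * q)"
      using c by (simp add: nat_pow_mult)
    also have "\<dots> = x [^] q \<otimes> (x [^] m \<otimes> d) \<oplus> x [^] q \<otimes> e [^] r"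
      unfolding d(2) using c dc by (intro r_distr) auto
    also have "x [^] q \<otimes> (x [^] m \<otimes> d) = x [^] m \<otimes> (x [^] q \<otimes> d)"
      using c dc by (simp add: m_assoc[symmetric] nat_pow_mult add.commute)
    also have "x [^] q \<otimes> e [^] r = x [^] m \<otimes> (b \<otimes> e [^] r) \<oplus> e [^] Suc r"
      using c nat_pow_Suc2[OF c(3), of r] by (simp add: eq l_distr m_assoc)
    finally have "x [^] (Suc r * q) = x [^] m \<otimes> (x [^] q \<otimes> d \<oplus> b \<otimes> e [^] r) \<oplus> e [^] Suc r"
      using c dc by (simp add: r_distr a_assoc del: nat_pow_Suc)
    then show ?case
      by (rule bexI) (intro sub(6,7) pow x e b d(1))
  qed
  then obtain d where "d \<in> S" "x [^] (k * q) = x [^] m \<otimes> d \<oplus> e [^] k" by blast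
  then show ?thesis
    using nil c sub(1) by (force simp: l_coset_def subset_iff)
qed

text \<open>
  Lifting along a nil ideal multiplies the exponent on the left by a nilpotency index, so the
  exponent on the right has to exceed that multiple beforehand.
\<close>

lemma (in monoid) pow_factor_descends:
  assumes x: "x \<in> carrier G" and a: "a \<in> carrier G"
    and eq: "x [^] (q::nat) = x [^] (q + 1) \<otimes> a"
  shows "x [^] q = x [^] (q + r) \<otimes> a [^] (r::nat)"
proof (induction r)
  case 0
  then show ?case using x by simp
next
  case (Suc r)
  have "x [^] (q + r) = x [^] r \<otimes> x [^] q"
    using x by (simp add: nat_pow_mult add.commute)
  also have "\<dots> = x [^] r \<otimes> x [^] (q + 1) \<otimes> a"
    unfolding eq using x a by (intro m_assoc[symmetric]) auto
  also have "x [^] r \<otimes> x [^] (q + 1) = x [^] (q + Suc r)"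
    using x by (simp only: nat_pow_mult) (simp add: add.commute)
  finally have "x [^] (q + r) \<otimes> a [^] r = x [^] (q + Suc r) \<otimes> a \<otimes> a [^] r"
    by simp
  also have "\<dots> = x [^] (q + Suc r) \<otimes> a [^] Suc r"
    unfolding nat_pow_Suc2[OF a] using x a by (intro m_assoc) auto
  finally show ?case
    by (rule trans[OF Suc])
qed

section \<open>The ring of generalized matrices\<close>

context generalized_matrix_ring
begin

\<comment> \<open>Membership in \<open>{1..n}\<close> is kept as an atomic condition, in which form it is a premise of
  the rules below.\<close>
declare atLeastAtMost_iff [simp del] One_nat_def [simp del]

abbreviation GM :: "(nat \<times> nat \<Rightarrow> 'a) ring"
  where "GM \<equiv> gm_ring n M \<theta>"

lemma entry_bimodule:
  "\<lbrakk>i \<in> {1..n}; j \<in> {1..n}\<rbrakk> \<Longrightarrow> bimodule (M i i) (M j j) (M i j) (\<theta> i i j) (\<theta> i j j)"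
  by (rule tensor_bimodule_hom.axioms(3)[OF theta_hom[of i i j]])

lemma entry_group: "\<lbrakk>i \<in> {1..n}; j \<in> {1..n}\<rbrakk> \<Longrightarrow> abelian_group (M i j)"
  by (rule bimodule.axioms(3)[OF entry_bimodule])

lemma entry_monoid: "\<lbrakk>i \<in> {1..n}; j \<in> {1..n}\<rbrakk> \<Longrightarrow> abelian_monoid (M i j)"
  by (rule abelian_group.axioms(1)[OF entry_group])

lemma entry_zero_closed: "\<lbrakk>i \<in> {1..n}; j \<in> {1..n}\<rbrakk> \<Longrightarrow> \<zero>\<^bsub>M i j\<^esub> \<in> carrier (M i j)"
  by (rule abelian_monoid.zero_closed[OF entry_monoid])

lemma entry_one_closed: "i \<in> {1..n} \<Longrightarrow> \<one>\<^bsub>M i i\<^esub> \<in> carrier (M i i)"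
  by (rule monoid.one_closed[OF ring.is_monoid[OF diag_ring]])

lemma theta_closed:
  "\<lbrakk>i \<in> {1..n}; j \<in> {1..n}; k \<in> {1..n}; x \<in> carrier (M i j); y \<in> carrier (M j k)\<rbrakk>
    \<Longrightarrow> \<theta> i j k x y \<in> carrier (M i k)"
  using tensor_bimodule_hom.hom_closed[OF theta_hom] .

lemma theta_add_left:
  "\<lbrakk>i \<in> {1..n}; j \<in> {1..n}; k \<in> {1..n}; x \<in> carrier (M i j); x' \<in> carrier (M i j);
    y \<in> carrier (M j k)\<rbrakk>
    \<Longrightarrow> \<theta> i j k (x \<oplus>\<^bsub>M i j\<^esub> x') y = \<theta> i j k x y \<oplus>\<^bsub>M i k\<^esub> \<theta> i j k x' y"
  using tensor_bimodule_hom.hom_add_left[OF theta_hom] .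

lemma theta_add_right:
  "\<lbrakk>i \<in> {1..n}; j \<in> {1..n}; k \<in> {1..n}; x \<in> carrier (M i j); y \<in> carrier (M j k);
    y' \<in> carrier (M j k)\<rbrakk>
    \<Longrightarrow> \<theta> i j k x (y \<oplus>\<^bsub>M j k\<^esub> y') = \<theta> i j k x y \<oplus>\<^bsub>M i k\<^esub> \<theta> i j k x y'"
  using tensor_bimodule_hom.hom_add_right[OF theta_hom] .

lemma theta_finsum_left:
  assumes "i \<in> {1..n}" "j \<in> {1..n}" "k \<in> {1..n}" "finite A" "f \<in> A \<rightarrow> carrier (M i j)"
    and "y \<in> carrier (M j k)"
  shows "\<theta> i j k (finsum (M i j) f A) y = (\<Oplus>\<^bsub>M i k\<^esub>a\<in>A. \<theta> i j k (f a) y)"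
  using assms by (intro additive_finsum[OF entry_group entry_group])
    (auto simp: theta_closed theta_add_left)

lemma theta_finsum_right:
  assumes "i \<in> {1..n}" "j \<in> {1..n}" "k \<in> {1..n}" "finite A" "f \<in> A \<rightarrow> carrier (M j k)"
    and "x \<in> carrier (M i j)"
  shows "\<theta> i j k x (finsum (M j k) f A) = (\<Oplus>\<^bsub>M i k\<^esub>a\<in>A. \<theta> i j k x (f a))"
  using assms by (intro additive_finsum[OF entry_group entry_group, where h = "\<theta> i j k x"])
    (auto simp: theta_closed theta_add_right)

lemma theta_zero_left:
  assumes "i \<in> {1..n}" "j \<in> {1..n}" "k \<in> {1..n}" "y \<in> carrier (M j k)"
  shows "\<theta> i j k \<zero>\<^bsub>M i j\<^esub> y = \<zero>\<^bsub>M i k\<^esub>"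
  using theta_finsum_left[of i j k "{}" "\<lambda>_. y" y] assms
  by (simp add: abelian_monoid.finsum_empty[OF entry_monoid])

lemma theta_zero_right:
  assumes "i \<in> {1..n}" "j \<in> {1..n}" "k \<in> {1..n}" "x \<in> carrier (M i j)"
  shows "\<theta> i j k x \<zero>\<^bsub>M j k\<^esub> = \<zero>\<^bsub>M i k\<^esub>"
  using theta_finsum_right[of i j k "{}" "\<lambda>_. x" x] assms
  by (simp add: abelian_monoid.finsum_empty[OF entry_monoid])

lemma theta_one_left:
  "\<lbrakk>i \<in> {1..n}; j \<in> {1..n}; x \<in> carrier (M i j)\<rbrakk> \<Longrightarrow> \<theta> i i j \<one>\<^bsub>M i i\<^esub> x = x"
  using bimodule.one_lsmult[OF entry_bimodule] .

lemma theta_one_right: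
  "\<lbrakk>i \<in> {1..n}; j \<in> {1..n}; x \<in> carrier (M i j)\<rbrakk> \<Longrightarrow> \<theta> i j j x \<one>\<^bsub>M j j\<^esub> = x"
  using bimodule.rsmult_one[OF entry_bimodule] .

lemma GM_entry_closed:
  "\<lbrakk>A \<in> carrier GM; i \<in> {1..n}; j \<in> {1..n}\<rbrakk> \<Longrightarrow> A (i, j) \<in> carrier (M i j)"
  by (auto simp: gm_ring_def PiE_iff)

lemma GM_eqI:
  assumes "A \<in> carrier GM" "B \<in> carrier GM"
    and "\<And>i j. \<lbrakk>i \<in> {1..n}; j \<in> {1..n}\<rbrakk> \<Longrightarrow> A (i, j) = B (i, j)"
  shows "A = B"
  using assms(1,2) by (intro PiE_ext[where k = "{1..n} \<times> {1..n}" and s = "\<lambda>(i, j). carrier (M i j)"])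
    (use assms(3) in \<open>auto simp: gm_ring_def\<close>)

lemma GM_mult_entry:
  "\<lbrakk>i \<in> {1..n}; k \<in> {1..n}\<rbrakk>
    \<Longrightarrow> (A \<otimes>\<^bsub>GM\<^esub> B) (i, k) = (\<Oplus>\<^bsub>M i k\<^esub>j\<in>{1..n}. \<theta> i j k (A (i, j)) (B (j, k)))"
  by (simp add: gm_ring_def)

lemma GM_add_entry:
  "\<lbrakk>i \<in> {1..n}; j \<in> {1..n}\<rbrakk> \<Longrightarrow> (A \<oplus>\<^bsub>GM\<^esub> B) (i, j) = A (i, j) \<oplus>\<^bsub>M i j\<^esub> B (i, j)"
  by (simp add: gm_ring_def)

lemma GM_zero_entry: "\<lbrakk>i \<in> {1..n}; j \<in> {1..n}\<rbrakk> \<Longrightarrow> \<zero>\<^bsub>GM\<^esub> (i, j) = \<zero>\<^bsub>M i j\<^esub>"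
  by (simp add: gm_ring_def)

lemma GM_one_entry:
  "\<lbrakk>i \<in> {1..n}; j \<in> {1..n}\<rbrakk>
    \<Longrightarrow> \<one>\<^bsub>GM\<^esub> (i, j) = (if i = j then \<one>\<^bsub>M i i\<^esub> else \<zero>\<^bsub>M i j\<^esub>)"
  by (simp add: gm_ring_def)

lemmas GM_entries = GM_mult_entry GM_add_entry GM_zero_entry GM_one_entry

lemma GM_mult_closed:
  assumes "A \<in> carrier GM" "B \<in> carrier GM"
  shows "A \<otimes>\<^bsub>GM\<^esub> B \<in> carrier GM"
proof -
  have "(\<Oplus>\<^bsub>M i k\<^esub>j\<in>{1..n}. \<theta> i j k (A (i, j)) (B (j, k))) \<in> carrier (M i k)"
    if "i \<in> {1..n}" "k \<in> {1..n}" for i k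
    using that assms
    by (intro abelian_monoid.finsum_closed[OF entry_monoid] Pi_I theta_closed GM_entry_closed)
  then show ?thesis
    by (auto simp: gm_ring_def)
qed

lemma GM_add_closed:
  assumes "A \<in> carrier GM" "B \<in> carrier GM"
  shows "A \<oplus>\<^bsub>GM\<^esub> B \<in> carrier GM"
proof -
  have "A (i, j) \<oplus>\<^bsub>M i j\<^esub> B (i, j) \<in> carrier (M i j)" if "i \<in> {1..n}" "j \<in> {1..n}" for i j
    using that assms
    by (intro abelian_monoid.a_closed[OF entry_monoid] GM_entry_closed)
  then show ?thesis
    by (auto simp: gm_ring_def)
qed

lemma GM_zero_closed: "\<zero>\<^bsub>GM\<^esub> \<in> carrier GM"
  using entry_zero_closed by (auto simp: gm_ring_def)

lemma GM_one_closed: "\<one>\<^bsub>GM\<^esub> \<in> carrier GM"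
  using entry_zero_closed entry_one_closed by (auto simp: gm_ring_def)

lemma GM_mult_assoc:
  assumes A: "A \<in> carrier GM" and B: "B \<in> carrier GM" and C: "C \<in> carrier GM"
  shows "A \<otimes>\<^bsub>GM\<^esub> B \<otimes>\<^bsub>GM\<^esub> C = A \<otimes>\<^bsub>GM\<^esub> (B \<otimes>\<^bsub>GM\<^esub> C)"
proof (rule GM_eqI)
  fix i l assume i: "i \<in> {1..n}" and l: "l \<in> {1..n}"
  interpret il: abelian_monoid "M i l" using entry_monoid[OF i l] .
  note cl = theta_closed GM_entry_closed A B C i l
  have "(A \<otimes>\<^bsub>GM\<^esub> B \<otimes>\<^bsub>GM\<^esub> C) (i, l) =
      (\<Oplus>\<^bsub>M i l\<^esub>k\<in>{1..n}. \<theta> i k l (\<Oplus>\<^bsub>M i k\<^esub>j\<in>{1..n}. \<theta> i j k (A (i, j)) (B (j, k))) (C (k, l)))"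
    using i l by (subst GM_mult_entry)
      (auto intro!: il.finsum_cong' simp: GM_mult_entry theta_finsum_left cl)
  also have "\<dots> = (\<Oplus>\<^bsub>M i l\<^esub>k\<in>{1..n}. \<Oplus>\<^bsub>M i l\<^esub>j\<in>{1..n}. \<theta> i k l (\<theta> i j k (A (i, j)) (B (j, k))) (C (k, l)))"
    by (intro il.finsum_cong') (auto intro!: theta_finsum_left il.finsum_closed simp: cl)
  also have "\<dots> = (\<Oplus>\<^bsub>M i l\<^esub>k\<in>{1..n}. \<Oplus>\<^bsub>M i l\<^esub>j\<in>{1..n}. \<theta> i j l (A (i, j)) (\<theta> j k l (B (j, k)) (C (k, l))))"
    by (intro il.finsum_cong') (auto intro!: theta_assoc il.finsum_closed simp: cl)
  also have "\<dots> = (\<Oplus>\<^bsub>M i l\<^esub>j\<in>{1..n}. \<Oplus>\<^bsub>M i l\<^esub>k\<in>{1..n}. \<theta> i j l (A (i, j)) (\<theta> j k l (B (j, k)) (C (k, l))))"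
    by (intro il.finsum_swap) (auto simp: cl)
  also have "\<dots> = (\<Oplus>\<^bsub>M i l\<^esub>j\<in>{1..n}. \<theta> i j l (A (i, j)) ((B \<otimes>\<^bsub>GM\<^esub> C) (j, l)))"
  proof (rule il.finsum_cong')
    show "(\<lambda>j. \<theta> i j l (A (i, j)) ((B \<otimes>\<^bsub>GM\<^esub> C) (j, l))) \<in> {1..n} \<rightarrow> carrier (M i l)"
      by (intro Pi_I theta_closed GM_entry_closed GM_mult_closed A B C i l)
  qed (simp_all add: GM_mult_entry theta_finsum_right Pi_iff cl)
  also have "\<dots> = (A \<otimes>\<^bsub>GM\<^esub> (B \<otimes>\<^bsub>GM\<^esub> C)) (i, l)"
    unfolding GM_mult_entry[OF i l] ..
  finally show "(A \<otimes>\<^bsub>GM\<^esub> B \<otimes>\<^bsub>GM\<^esub> C) (i, l) = (A \<otimes>\<^bsub>GM\<^esub> (B \<otimes>\<^bsub>GM\<^esub> C)) (i, l)" .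
qed (use assms GM_mult_closed in auto)

lemma GM_one_mult:
  assumes A: "A \<in> carrier GM"
  shows "\<one>\<^bsub>GM\<^esub> \<otimes>\<^bsub>GM\<^esub> A = A"
proof (rule GM_eqI)
  fix i l assume i: "i \<in> {1..n}" and l: "l \<in> {1..n}"
  have "(\<Oplus>\<^bsub>M i l\<^esub>j\<in>{1..n}. \<theta> i j l (\<one>\<^bsub>GM\<^esub> (i, j)) (A (j, l))) = \<theta> i i l (\<one>\<^bsub>GM\<^esub> (i, i)) (A (i, l))"
    using i l A by (intro abelian_monoid.finsum_single[OF entry_monoid])
      (auto simp: GM_one_entry theta_zero_left theta_one_left GM_entry_closed)
  then show "(\<one>\<^bsub>GM\<^esub> \<otimes>\<^bsub>GM\<^esub> A) (i, l) = A (i, l)"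
    using i l A by (simp add: GM_mult_entry GM_one_entry theta_one_left GM_entry_closed)
qed (use A GM_mult_closed GM_one_closed in auto)

lemma GM_mult_one:
  assumes A: "A \<in> carrier GM"
  shows "A \<otimes>\<^bsub>GM\<^esub> \<one>\<^bsub>GM\<^esub> = A"
proof (rule GM_eqI)
  fix i l assume i: "i \<in> {1..n}" and l: "l \<in> {1..n}"
  have "(\<Oplus>\<^bsub>M i l\<^esub>j\<in>{1..n}. \<theta> i j l (A (i, j)) (\<one>\<^bsub>GM\<^esub> (j, l))) = \<theta> i l l (A (i, l)) (\<one>\<^bsub>GM\<^esub> (l, l))"
    using i l A by (intro abelian_monoid.finsum_single[OF entry_monoid])
      (auto simp: GM_one_entry theta_zero_right theta_one_right GM_entry_closed)
  then show "(A \<otimes>\<^bsub>GM\<^esub> \<one>\<^bsub>GM\<^esub>) (i, l) = A (i, l)"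
    using i l A by (simp add: GM_mult_entry GM_one_entry theta_one_right GM_entry_closed)
qed (use A GM_mult_closed GM_one_closed in auto)

lemma GM_add_mult:
  assumes A: "A \<in> carrier GM" and B: "B \<in> carrier GM" and C: "C \<in> carrier GM"
  shows "(A \<oplus>\<^bsub>GM\<^esub> B) \<otimes>\<^bsub>GM\<^esub> C = A \<otimes>\<^bsub>GM\<^esub> C \<oplus>\<^bsub>GM\<^esub> B \<otimes>\<^bsub>GM\<^esub> C"
proof (rule GM_eqI)
  fix i l assume i: "i \<in> {1..n}" and l: "l \<in> {1..n}"
  interpret il: abelian_monoid "M i l" using entry_monoid[OF i l] .
  note cl = theta_closed GM_entry_closed A B C i l
  have "((A \<oplus>\<^bsub>GM\<^esub> B) \<otimes>\<^bsub>GM\<^esub> C) (i, l) =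
      (\<Oplus>\<^bsub>M i l\<^esub>j\<in>{1..n}. \<theta> i j l (A (i, j)) (C (j, l)) \<oplus>\<^bsub>M i l\<^esub> \<theta> i j l (B (i, j)) (C (j, l)))"
    unfolding GM_mult_entry[OF i l]
    by (rule il.finsum_cong') (auto simp: GM_add_entry theta_add_left cl)
  also have "\<dots> = (A \<otimes>\<^bsub>GM\<^esub> C \<oplus>\<^bsub>GM\<^esub> B \<otimes>\<^bsub>GM\<^esub> C) (i, l)"
    by (simp add: GM_mult_entry GM_add_entry il.finsum_addf Pi_iff cl)
  finally show "((A \<oplus>\<^bsub>GM\<^esub> B) \<otimes>\<^bsub>GM\<^esub> C) (i, l) = (A \<otimes>\<^bsub>GM\<^esub> C \<oplus>\<^bsub>GM\<^esub> B \<otimes>\<^bsub>GM\<^esub> C) (i, l)" .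
qed (use assms GM_mult_closed GM_add_closed in auto)

lemma GM_mult_add:
  assumes A: "A \<in> carrier GM" and B: "B \<in> carrier GM" and C: "C \<in> carrier GM"
  shows "C \<otimes>\<^bsub>GM\<^esub> (A \<oplus>\<^bsub>GM\<^esub> B) = C \<otimes>\<^bsub>GM\<^esub> A \<oplus>\<^bsub>GM\<^esub> C \<otimes>\<^bsub>GM\<^esub> B"
proof (rule GM_eqI)
  fix i l assume i: "i \<in> {1..n}" and l: "l \<in> {1..n}"
  interpret il: abelian_monoid "M i l" using entry_monoid[OF i l] .
  note cl = theta_closed GM_entry_closed A B C i l
  have "(C \<otimes>\<^bsub>GM\<^esub> (A \<oplus>\<^bsub>GM\<^esub> B)) (i, l) =
      (\<Oplus>\<^bsub>M i l\<^esub>j\<in>{1..n}. \<theta> i j l (C (i, j)) (A (j, l)) \<oplus>\<^bsub>M i l\<^esub> \<theta> i j l (C (i, j)) (B (j, l)))"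
    unfolding GM_mult_entry[OF i l]
    by (rule il.finsum_cong') (auto simp: GM_add_entry theta_add_right cl)
  also have "\<dots> = (C \<otimes>\<^bsub>GM\<^esub> A \<oplus>\<^bsub>GM\<^esub> C \<otimes>\<^bsub>GM\<^esub> B) (i, l)"
    by (simp add: GM_mult_entry GM_add_entry il.finsum_addf Pi_iff cl)
  finally show "(C \<otimes>\<^bsub>GM\<^esub> (A \<oplus>\<^bsub>GM\<^esub> B)) (i, l) = (C \<otimes>\<^bsub>GM\<^esub> A \<oplus>\<^bsub>GM\<^esub> C \<otimes>\<^bsub>GM\<^esub> B) (i, l)" .
qed (use assms GM_mult_closed GM_add_closed in auto)

lemma ring_GM: "ring GM"
proof (rule ringI)
  show "abelian_group GM"
  proof (rule abelian_groupI)
    fix A assume A: "A \<in> carrier GM"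
    define B where "B = (\<lambda>(i, j) \<in> {1..n} \<times> {1..n}. \<ominus>\<^bsub>M i j\<^esub> A (i, j))"
    have "\<ominus>\<^bsub>M i j\<^esub> A (i, j) \<in> carrier (M i j)" if "i \<in> {1..n}" "j \<in> {1..n}" for i j
      using that by (intro abelian_group.a_inv_closed[OF entry_group] GM_entry_closed A)
    then have B: "B \<in> carrier GM"
      by (auto simp: B_def gm_ring_def)
    have "B \<oplus>\<^bsub>GM\<^esub> A = \<zero>\<^bsub>GM\<^esub>"
      using A B by (intro GM_eqI GM_add_closed GM_zero_closed)
        (auto simp: GM_entries B_def abelian_group.l_neg[OF entry_group] GM_entry_closed)
    then show "\<exists>B\<in>carrier GM. B \<oplus>\<^bsub>GM\<^esub> A = \<zero>\<^bsub>GM\<^esub>"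
      using B by blast
  next
    fix A B C assume "A \<in> carrier GM" "B \<in> carrier GM" "C \<in> carrier GM"
    then show "A \<oplus>\<^bsub>GM\<^esub> B \<oplus>\<^bsub>GM\<^esub> C = A \<oplus>\<^bsub>GM\<^esub> (B \<oplus>\<^bsub>GM\<^esub> C)"
      by (intro GM_eqI GM_add_closed)
        (auto simp: GM_add_entry abelian_monoid.a_assoc[OF entry_monoid] GM_entry_closed)
  next
    fix A B assume "A \<in> carrier GM" "B \<in> carrier GM"
    then show "A \<oplus>\<^bsub>GM\<^esub> B = B \<oplus>\<^bsub>GM\<^esub> A"
      by (intro GM_eqI GM_add_closed)
        (auto simp: GM_add_entry abelian_monoid.a_comm[OF entry_monoid] GM_entry_closed)
  next
    fix A assume "A \<in> carrier GM"
    then show "\<zero>\<^bsub>GM\<^esub> \<oplus>\<^bsub>GM\<^esub> A = A"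
      by (intro GM_eqI GM_add_closed GM_zero_closed)
        (auto simp: GM_entries abelian_monoid.l_zero[OF entry_monoid] GM_entry_closed)
  qed (auto intro: GM_add_closed GM_zero_closed)
  show "monoid GM"
    by (rule monoidI)
      (auto simp: GM_mult_closed GM_one_closed GM_mult_assoc GM_one_mult GM_mult_one)
qed (simp_all only: GM_add_mult GM_mult_add)

lemma GM_finsum_entry:
  assumes "finite A" "f \<in> A \<rightarrow> carrier GM" and i: "i \<in> {1..n}" and j: "j \<in> {1..n}"
  shows "finsum GM f A (i, j) = (\<Oplus>\<^bsub>M i j\<^esub>a\<in>A. f a (i, j))"
proof -
  have "(\<lambda>A. A (i, j)) (finsum GM f A) = (\<Oplus>\<^bsub>M i j\<^esub>a\<in>A. (\<lambda>A. A (i, j)) (f a))"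
    using assms(1,2) i j
    by (intro additive_finsum[OF ring.is_abelian_group[OF ring_GM] entry_group[OF i j]]
       GM_add_entry GM_entry_closed)
  then show ?thesis by simp
qed

section \<open>Matrices with a single nonzero entry\<close>

definition matrix_unit :: "nat \<Rightarrow> nat \<Rightarrow> 'a \<Rightarrow> nat \<times> nat \<Rightarrow> 'a"
  where "matrix_unit i j a =
    (\<lambda>(k, l) \<in> {1..n} \<times> {1..n}. if k = i \<and> l = j then a else \<zero>\<^bsub>M k l\<^esub>)"

lemma diag_unit_eq: "diag_unit n M i = matrix_unit i i \<one>\<^bsub>M i i\<^esub>"
  by (simp add: diag_unit_def matrix_unit_def)

lemma matrix_unit_entry:
  "\<lbrakk>k \<in> {1..n}; l \<in> {1..n}\<rbrakk>
    \<Longrightarrow> matrix_unit i j a (k, l) = (if k = i \<and> l = j then a else \<zero>\<^bsub>M k l\<^esub>)"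
  by (simp add: matrix_unit_def)

lemma matrix_unit_closed:
  "\<lbrakk>i \<in> {1..n}; j \<in> {1..n}; a \<in> carrier (M i j)\<rbrakk> \<Longrightarrow> matrix_unit i j a \<in> carrier GM"
  using entry_zero_closed by (auto simp: matrix_unit_def gm_ring_def)

lemma diag_unit_closed: "i \<in> {1..n} \<Longrightarrow> diag_unit n M i \<in> carrier GM"
  by (simp add: diag_unit_eq matrix_unit_closed entry_one_closed)

lemma matrix_unit_zero_iff:
  assumes "i \<in> {1..n}" "j \<in> {1..n}"
  shows "matrix_unit i j a = \<zero>\<^bsub>GM\<^esub> \<longleftrightarrow> a = \<zero>\<^bsub>M i j\<^esub>"
proof
  assume "matrix_unit i j a = \<zero>\<^bsub>GM\<^esub>"
  then have "matrix_unit i j a (i, j) = \<zero>\<^bsub>GM\<^esub> (i, j)" by simp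
  then show "a = \<zero>\<^bsub>M i j\<^esub>"
    using assms by (simp add: matrix_unit_entry GM_zero_entry)
next
  assume "a = \<zero>\<^bsub>M i j\<^esub>"
  then show "matrix_unit i j a = \<zero>\<^bsub>GM\<^esub>"
    using assms
    by (intro GM_eqI matrix_unit_closed GM_zero_closed)
      (auto simp: entry_zero_closed matrix_unit_entry GM_zero_entry)
qed

lemma matrix_unit_mult_entry:
  assumes i: "i \<in> {1..n}" and j: "j \<in> {1..n}" and a: "a \<in> carrier (M i j)"
    and B: "B \<in> carrier GM" and k: "k \<in> {1..n}" and l: "l \<in> {1..n}"
  shows "(matrix_unit i j a \<otimes>\<^bsub>GM\<^esub> B) (k, l) =
    (if k = i then \<theta> i j l a (B (j, l)) else \<zero>\<^bsub>M k l\<^esub>)"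
proof -
  have "(\<Oplus>\<^bsub>M k l\<^esub>r\<in>{1..n}. \<theta> k r l (matrix_unit i j a (k, r)) (B (r, l))) =
      \<theta> k j l (matrix_unit i j a (k, j)) (B (j, l))"
    using assms by (intro abelian_monoid.finsum_single[OF entry_monoid])
      (auto simp: matrix_unit_entry theta_zero_left theta_closed GM_entry_closed entry_zero_closed)
  then show ?thesis
    using assms by (simp add: GM_mult_entry matrix_unit_entry theta_zero_left GM_entry_closed)
qed

lemma mult_matrix_unit_entry:
  assumes i: "i \<in> {1..n}" and j: "j \<in> {1..n}" and a: "a \<in> carrier (M i j)"
    and B: "B \<in> carrier GM" and k: "k \<in> {1..n}" and l: "l \<in> {1..n}"
  shows "(B \<otimes>\<^bsub>GM\<^esub> matrix_unit i j a) (k, l) =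
    (if l = j then \<theta> k i j (B (k, i)) a else \<zero>\<^bsub>M k l\<^esub>)"
proof -
  have "(\<Oplus>\<^bsub>M k l\<^esub>r\<in>{1..n}. \<theta> k r l (B (k, r)) (matrix_unit i j a (r, l))) =
      \<theta> k i l (B (k, i)) (matrix_unit i j a (i, l))"
    using assms by (intro abelian_monoid.finsum_single[OF entry_monoid])
      (auto simp: matrix_unit_entry theta_zero_right theta_closed GM_entry_closed entry_zero_closed)
  then show ?thesis
    using assms by (simp add: GM_mult_entry matrix_unit_entry theta_zero_right GM_entry_closed)
qed

text \<open>
  Both the corners \<open>E\<^sub>i\<^sub>i B E\<^sub>i\<^sub>i\<close> and the products \<open>s y E\<^sub>j\<^sub>j\<close>, \<open>E\<^sub>i\<^sub>i y s\<close> of the main argument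
  have this form.
\<close>

lemma matrix_unit_sandwich:
  assumes i: "i \<in> {1..n}" and j: "j \<in> {1..n}" and a: "a \<in> carrier (M i j)"
    and B: "B \<in> carrier GM"
    and k: "k \<in> {1..n}" and l: "l \<in> {1..n}" and c: "c \<in> carrier (M k l)"
  shows "matrix_unit i j a \<otimes>\<^bsub>GM\<^esub> B \<otimes>\<^bsub>GM\<^esub> matrix_unit k l c =
    matrix_unit i l (\<theta> i k l (\<theta> i j k a (B (j, k))) c)"
proof (rule GM_eqI)
  show "matrix_unit i j a \<otimes>\<^bsub>GM\<^esub> B \<otimes>\<^bsub>GM\<^esub> matrix_unit k l c \<in> carrier GM"
    using assms by (intro GM_mult_closed matrix_unit_closed)
  show "matrix_unit i l (\<theta> i k l (\<theta> i j k a (B (j, k))) c) \<in> carrier GM"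
    using assms by (simp add: matrix_unit_closed theta_closed GM_entry_closed)
next
  fix r s assume "r \<in> {1..n}" "s \<in> {1..n}"
  then show "(matrix_unit i j a \<otimes>\<^bsub>GM\<^esub> B \<otimes>\<^bsub>GM\<^esub> matrix_unit k l c) (r, s) =
      matrix_unit i l (\<theta> i k l (\<theta> i j k a (B (j, k))) c) (r, s)"
    using assms
    by (auto simp: mult_matrix_unit_entry matrix_unit_mult_entry matrix_unit_entry GM_mult_closed
        matrix_unit_closed theta_zero_left)
qed

lemma finsum_diag_units: "finsum GM (diag_unit n M) {1..n} = \<one>\<^bsub>GM\<^esub>"
proof (rule GM_eqI)
  show "finsum GM (diag_unit n M) {1..n} \<in> carrier GM"
    using ring.is_abelian_group[OF ring_GM] diag_unit_closed
    by (intro abelian_monoid.finsum_closed Pi_I) (auto simp: abelian_group_def)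
next
  fix k l assume k: "k \<in> {1..n}" and l: "l \<in> {1..n}"
  have "finsum GM (diag_unit n M) {1..n} (k, l) = (\<Oplus>\<^bsub>M k l\<^esub>i\<in>{1..n}. diag_unit n M i (k, l))"
    using k l diag_unit_closed by (intro GM_finsum_entry) auto
  also have "\<dots> = diag_unit n M k (k, l)"
    using k l by (intro abelian_monoid.finsum_single[OF entry_monoid])
      (auto simp: diag_unit_eq matrix_unit_entry entry_zero_closed entry_one_closed)
  finally show "finsum GM (diag_unit n M) {1..n} (k, l) = \<one>\<^bsub>GM\<^esub> (k, l)"
    using k l by (auto simp: diag_unit_eq matrix_unit_entry GM_one_entry)
qed (rule GM_one_closed)

section \<open>Annihilating matrices\<close>

text \<open>
  The relation \<open>P\<close> selects the constrained positions: below the diagonal for the lower annihilating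
  subring, above it for the upper one.
\<close>

definition annihilating :: "(nat \<Rightarrow> nat \<Rightarrow> bool) \<Rightarrow> (nat \<times> nat \<Rightarrow> 'a) set"
  where "annihilating P = {A \<in> carrier GM. \<forall>i\<in>{1..n}. \<forall>j\<in>{1..n}. P i j \<longrightarrow>
    A (i, j) \<in> right_ann M \<theta> i j \<inter> left_ann M \<theta> i j}"

lemma lower_annihilating_eq: "lower_annihilating n M \<theta> = annihilating (\<lambda>i j. i > j)"
  by (simp add: lower_annihilating_def annihilating_def)

lemma upper_annihilating_eq: "upper_annihilating n M \<theta> = annihilating (\<lambda>i j. i < j)"
  by (simp add: upper_annihilating_def annihilating_def)

lemma annihilating_closed: "A \<in> annihilating P \<Longrightarrow> A \<in> carrier GM"
  by (simp add: annihilating_def)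

lemma zero_in_annihilators:
  "\<lbrakk>i \<in> {1..n}; j \<in> {1..n}\<rbrakk> \<Longrightarrow> \<zero>\<^bsub>M i j\<^esub> \<in> right_ann M \<theta> i j \<inter> left_ann M \<theta> i j"
  by (simp add: right_ann_def left_ann_def theta_zero_left theta_zero_right entry_zero_closed)

lemma diag_matrices_annihilating:
  assumes "irreflp P"
  shows "diag_matrices n M \<theta> \<subseteq> annihilating P"
proof
  fix A assume A: "A \<in> diag_matrices n M \<theta>"
  have "A (i, j) \<in> right_ann M \<theta> i j \<inter> left_ann M \<theta> i j"
    if "i \<in> {1..n}" "j \<in> {1..n}" "P i j" for i j
  proof -
    have "A (i, j) = \<zero>\<^bsub>M i j\<^esub>"
      using that A assms by (cases "i = j") (auto simp: diag_matrices_def dest: irreflpD)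
    then show ?thesis
      using that zero_in_annihilators by simp
  qed
  then show "A \<in> annihilating P"
    using A unfolding annihilating_def diag_matrices_def by blast
qed

lemma matrix_unit_annihilating:
  assumes "\<not> P i j" "i \<in> {1..n}" "j \<in> {1..n}" "a \<in> carrier (M i j)"
  shows "matrix_unit i j a \<in> annihilating P"
proof -
  have "matrix_unit i j a (k, l) \<in> right_ann M \<theta> k l \<inter> left_ann M \<theta> k l"
    if "k \<in> {1..n}" "l \<in> {1..n}" "P k l" for k l
  proof -
    have "matrix_unit i j a (k, l) = \<zero>\<^bsub>M k l\<^esub>"
      using that assms by (auto simp: matrix_unit_entry)
    then show ?thesis
      using that zero_in_annihilators by simp
  qed
  then show ?thesis
    using assms matrix_unit_closed unfolding annihilating_def by blast
qed

text \<open>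
  Totality of \<open>P\<close> makes one of the two positions constrained, and the annihilator condition is
  two-sided, so it does not matter whether the constrained factor comes first or second.
\<close>

lemma annihilating_opposite_entries:
  assumes tot: "totalp P"
    and A: "A \<in> annihilating P" and B: "B \<in> annihilating P"
    and i: "i \<in> {1..n}" and j: "j \<in> {1..n}" and ij: "i \<noteq> j"
  shows "\<theta> i j i (A (i, j)) (B (j, i)) = \<zero>\<^bsub>M i i\<^esub>"
proof -
  have cl: "A (i, j) \<in> carrier (M i j)" "B (j, i) \<in> carrier (M j i)"
    using A B i j by (auto intro: GM_entry_closed annihilating_closed)
  consider "P i j" | "P j i" using totalpD[OF tot ij] by blast
  then show ?thesis
  proof cases
    case 1
    then have "A (i, j) \<in> left_ann M \<theta> i j"
      using A i j by (simp add: annihilating_def)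
    then show ?thesis using cl by (simp add: left_ann_def)
  next
    case 2
    then have "B (j, i) \<in> right_ann M \<theta> j i"
      using B i j by (simp add: annihilating_def)
    then show ?thesis using cl by (simp add: right_ann_def)
  qed
qed

text \<open>
  The terms of \<open>(A B)\<^sub>i\<^sub>i\<close> that pass through an index \<open>j \<noteq> i\<close> are products of opposite entries.
\<close>

lemma annihilating_diag_mult:
  assumes tot: "totalp P"
    and A: "A \<in> annihilating P" and B: "B \<in> annihilating P" and i: "i \<in> {1..n}"
  shows "(A \<otimes>\<^bsub>GM\<^esub> B) (i, i) = A (i, i) \<otimes>\<^bsub>M i i\<^esub> B (i, i)"
proof -
  have "(\<Oplus>\<^bsub>M i i\<^esub>j\<in>{1..n}. \<theta> i j i (A (i, j)) (B (j, i))) = \<theta> i i i (A (i, i)) (B (i, i))"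
    using i annihilating_opposite_entries[OF tot A B i]
    by (intro abelian_monoid.finsum_single[OF entry_monoid])
      (simp_all add: theta_closed GM_entry_closed annihilating_closed[OF A] annihilating_closed[OF B])
  then show ?thesis
    using i A B by (simp add: GM_mult_entry theta_diag GM_entry_closed annihilating_closed)
qed

lemma annihilating_diag_pow:
  assumes tot: "totalp P" and S: "subring (annihilating P) GM"
    and A: "A \<in> annihilating P" and i: "i \<in> {1..n}"
  shows "A [^]\<^bsub>GM\<^esub> (r::nat) \<in> annihilating P \<and>
    (A [^]\<^bsub>GM\<^esub> r) (i, i) = A (i, i) [^]\<^bsub>M i i\<^esub> r"
proof (induction r)
  case 0
  then show ?case using subringE(3)[OF S] i by (simp add: GM_one_entry)
next
  case (Suc r)
  then show ?case
    using subringE(6)[OF S] A i by (simp add: annihilating_diag_mult[OF tot])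
qed

text \<open>
  The matrix units \<open>E\<^sub>i\<^sub>i\<close> satisfy the hypothesis of \<open>nilpotent_of_corners\<close>: the corner
  \<open>E\<^sub>i\<^sub>i (A T) E\<^sub>i\<^sub>i\<close> carries only the diagonal entry of \<open>A T\<close>, which is the product of the diagonal
  entries of \<open>A\<close> and \<open>T\<close>.
\<close>

lemma annihilating_nilpotent:
  assumes tot: "totalp P" and irr: "irreflp P"
    and S: "subring (annihilating P) GM" and A: "A \<in> annihilating P"
    and diag: "\<And>i. i \<in> {1..n} \<Longrightarrow> A (i, i) = \<zero>\<^bsub>M i i\<^esub>"
  shows "A [^]\<^bsub>GM\<^esub> n = \<zero>\<^bsub>GM\<^esub>"
proof -
  have "A [^]\<^bsub>GM\<^esub> card {1..n} = \<zero>\<^bsub>GM\<^esub>"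
  proof (rule ring.nilpotent_of_corners[OF ring_GM S])
    fix i assume i: "i \<in> {1..n}"
    then show "diag_unit n M i \<in> annihilating P"
      by (simp add: diag_unit_eq matrix_unit_annihilating irreflpD[OF irr] entry_one_closed)
  next
    fix i T assume i: "i \<in> {1..n}" and T: "T \<in> annihilating P"
    have AT: "A \<otimes>\<^bsub>GM\<^esub> T \<in> carrier GM"
      using A T by (intro GM_mult_closed annihilating_closed)
    have "(A \<otimes>\<^bsub>GM\<^esub> T) (i, i) = \<theta> i i i \<zero>\<^bsub>M i i\<^esub> (T (i, i))"
      using i T diag by (simp add: annihilating_diag_mult[OF tot A] theta_diag entry_zero_closed
          GM_entry_closed annihilating_closed)
    then have "(A \<otimes>\<^bsub>GM\<^esub> T) (i, i) = \<zero>\<^bsub>M i i\<^esub>"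
      using i T by (simp add: theta_zero_left GM_entry_closed annihilating_closed)
    then show "diag_unit n M i \<otimes>\<^bsub>GM\<^esub> (A \<otimes>\<^bsub>GM\<^esub> T) \<otimes>\<^bsub>GM\<^esub> diag_unit n M i = \<zero>\<^bsub>GM\<^esub>"
      using i AT by (simp add: diag_unit_eq matrix_unit_sandwich entry_one_closed
          theta_one_left theta_one_right entry_zero_closed matrix_unit_zero_iff)
  qed (simp_all add: finsum_diag_units A)
  then show ?thesis by simp
qed

text \<open>
  Strong \<open>\<pi>\<close>-regularity lifts from the diagonal of \<open>y\<close> to \<open>y\<close>, because an element of the subring
  is determined by its diagonal up to a nilpotent one.
\<close>

lemma annihilating_strongly_pi_regular:
  assumes n: "n > 0"
    and tot: "totalp P" and irr: "irreflp P"
    and S: "subring (annihilating P) GM"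
    and D: "strongly_pi_regular (GM\<lparr>carrier := diag_matrices n M \<theta>\<rparr>)"
    and y: "y \<in> annihilating P"
  shows "\<exists>p::nat. p > 0 \<and> y [^]\<^bsub>GM\<^esub> p \<in> y [^]\<^bsub>GM\<^esub> (p + 1) <#\<^bsub>GM\<^esub> annihilating P"
proof -
  interpret GM: ring GM by (rule ring_GM)
  note sub = subringE[OF S]
  have DS: "diag_matrices n M \<theta> \<subseteq> annihilating P"
    using irr by (rule diag_matrices_annihilating)
  define d where "d = (\<lambda>(i, j) \<in> {1..n} \<times> {1..n}. if i = j then y (i, i) else \<zero>\<^bsub>M i j\<^esub>)"
  have "d \<in> carrier GM"
    using entry_zero_closed GM_entry_closed[OF annihilating_closed[OF y]]
    by (auto simp: d_def gm_ring_def)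
  then have dD: "d \<in> diag_matrices n M \<theta>"
    by (auto simp: diag_matrices_def d_def)
  have dd: "d (i, i) = y (i, i)" if "i \<in> {1..n}" for i
    using that by (simp add: d_def)
  obtain q :: nat and a where q: "q > 0" and a: "a \<in> diag_matrices n M \<theta>"
    and dq: "d [^]\<^bsub>GM\<^esub> q = d [^]\<^bsub>GM\<^esub> (q + 1) \<otimes>\<^bsub>GM\<^esub> a"
    using D dD unfolding strongly_pi_regular_def by (auto simp: l_coset_def nat_pow_def)
  have dS: "d \<in> annihilating P" and aS: "a \<in> annihilating P"
    using dD a DS by auto
  \<comment> \<open>The error term \<open>e\<close> below satisfies \<open>e\<^sup>n = 0\<close>, which leads from exponent \<open>q\<close> to \<open>n q\<close>;
    the exponent \<open>m\<close> is one more than that.\<close>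
  define m where "m = n * q + 1"
  define b where "b = a [^]\<^bsub>GM\<^esub> (m - q)"
  have m: "q + (m - q) = m"
    using n by (simp add: m_def trans_le_add1)
  have dm: "d [^]\<^bsub>GM\<^esub> q = d [^]\<^bsub>GM\<^esub> m \<otimes>\<^bsub>GM\<^esub> b"
    using GM.pow_factor_descends[OF annihilating_closed[OF dS] annihilating_closed[OF aS] dq, of "m - q"]
    unfolding m b_def .
  note pow = annihilating_diag_pow[OF tot S]
  have bS: "b \<in> annihilating P"
    using pow[OF aS, of 1] n unfolding b_def by (simp add: atLeastAtMost_iff)
  have powS: "y [^]\<^bsub>GM\<^esub> r \<in> annihilating P" "d [^]\<^bsub>GM\<^esub> r \<in> annihilating P" for r :: nat
    using pow[OF y, of 1] pow[OF dS, of 1] n by (simp_all add: atLeastAtMost_iff)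
  define e where "e = y [^]\<^bsub>GM\<^esub> q \<ominus>\<^bsub>GM\<^esub> y [^]\<^bsub>GM\<^esub> m \<otimes>\<^bsub>GM\<^esub> b"
  have eS: "e \<in> annihilating P"
    unfolding e_def GM.minus_eq by (intro sub(5-7) powS bS)
  note cl = annihilating_closed[OF bS] annihilating_closed[OF powS(1)]
    annihilating_closed[OF eS]
  have eq: "y [^]\<^bsub>GM\<^esub> q = y [^]\<^bsub>GM\<^esub> m \<otimes>\<^bsub>GM\<^esub> b \<oplus>\<^bsub>GM\<^esub> e"
    using cl unfolding e_def GM.minus_eq by (simp add: GM.a_lcomm GM.r_neg)
  have "e (i, i) = \<zero>\<^bsub>M i i\<^esub>" if i: "i \<in> {1..n}" for i
  proof -
    interpret ii: abelian_group "M i i" using entry_group[OF i i] .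
    have ymb: "y [^]\<^bsub>GM\<^esub> m \<otimes>\<^bsub>GM\<^esub> b \<in> annihilating P"
      by (intro sub(6) powS bS)
    have "(y [^]\<^bsub>GM\<^esub> m \<otimes>\<^bsub>GM\<^esub> b) (i, i) = (d [^]\<^bsub>GM\<^esub> m \<otimes>\<^bsub>GM\<^esub> b) (i, i)"
      using i powS bS pow[OF y i] pow[OF dS i] dd by (simp add: annihilating_diag_mult[OF tot])
    also have "\<dots> = (y [^]\<^bsub>GM\<^esub> q) (i, i)"
      unfolding dm[symmetric] using i pow[OF y i] pow[OF dS i] dd by simp
    also have "\<dots> = (y [^]\<^bsub>GM\<^esub> m \<otimes>\<^bsub>GM\<^esub> b) (i, i) \<oplus>\<^bsub>M i i\<^esub> e (i, i)"
      unfolding eq by (rule GM_add_entry[OF i i])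
    finally show ?thesis
      using GM_entry_closed[OF annihilating_closed[OF ymb] i i]
        GM_entry_closed[OF annihilating_closed[OF eS] i i]
      by (simp add: ii.add.r_cancel_one')
  qed
  then have "e [^]\<^bsub>GM\<^esub> n = \<zero>\<^bsub>GM\<^esub>"
    by (intro annihilating_nilpotent[OF tot irr S eS])
  then have "y [^]\<^bsub>GM\<^esub> (n * q) \<in> y [^]\<^bsub>GM\<^esub> (n * q + 1) <#\<^bsub>GM\<^esub> annihilating P"
    by (rule GM.pow_in_coset_of_nilpotent[OF S y bS eS eq, unfolded m_def])
  then show ?thesis
    using n q by (intro exI[of _ "n * q"]) simp
qed

text \<open>
  An entry of \<open>y\<close> that violates its annihilator condition is detected by an element \<open>b\<close> of the
  opposite bimodule; as \<open>P\<close> is asymmetric, the opposite position is unconstrained, so the matrix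
  unit with entry \<open>b\<close> there can serve as \<open>s\<close>.
\<close>

lemma non_annihilating_diagonal_corner:
  assumes asym: "asymp P"
    and y: "y \<in> carrier GM" "y \<notin> annihilating P"
  obtains i j s where "i \<in> {1..n}" "j \<in> {1..n}" "s \<in> annihilating P"
    "s \<otimes>\<^bsub>GM\<^esub> y \<otimes>\<^bsub>GM\<^esub> diag_unit n M j \<in> annihilating P \<and>
       s \<otimes>\<^bsub>GM\<^esub> y \<otimes>\<^bsub>GM\<^esub> diag_unit n M j \<noteq> \<zero>\<^bsub>GM\<^esub> \<or>
     diag_unit n M i \<otimes>\<^bsub>GM\<^esub> y \<otimes>\<^bsub>GM\<^esub> s \<in> annihilating P \<and>
       diag_unit n M i \<otimes>\<^bsub>GM\<^esub> y \<otimes>\<^bsub>GM\<^esub> s \<noteq> \<zero>\<^bsub>GM\<^esub>"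
proof -
  have irr: "irreflp P"
    using asym by (rule irreflp_on_if_asymp_on)
  obtain i j where i: "i \<in> {1..n}" and j: "j \<in> {1..n}" and Pij: "P i j"
    and nann: "y (i, j) \<notin> right_ann M \<theta> i j \<inter> left_ann M \<theta> i j"
    using y unfolding annihilating_def by blast
  have yij: "y (i, j) \<in> carrier (M i j)"
    using y(1) i j by (rule GM_entry_closed)
  then obtain b where b: "b \<in> carrier (M j i)"
    and ne: "\<theta> j i j b (y (i, j)) \<noteq> \<zero>\<^bsub>M j j\<^esub> \<or> \<theta> i j i (y (i, j)) b \<noteq> \<zero>\<^bsub>M i i\<^esub>"
    using nann unfolding right_ann_def left_ann_def by blast
  define s where "s = matrix_unit j i b"
  have s: "s \<in> annihilating P"
    unfolding s_def using asympD[OF asym Pij] j i b by (rule matrix_unit_annihilating)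
  have "s \<otimes>\<^bsub>GM\<^esub> y \<otimes>\<^bsub>GM\<^esub> diag_unit n M j = matrix_unit j j (\<theta> j i j b (y (i, j)))"
    using i j b y(1) yij by (simp add: s_def diag_unit_eq matrix_unit_sandwich entry_one_closed
        theta_one_right theta_closed)
  moreover have "diag_unit n M i \<otimes>\<^bsub>GM\<^esub> y \<otimes>\<^bsub>GM\<^esub> s = matrix_unit i i (\<theta> i j i (y (i, j)) b)"
    using i j b y(1) yij by (simp add: s_def diag_unit_eq matrix_unit_sandwich entry_one_closed
        theta_one_left)
  ultimately show thesis
    using that[OF i j s] ne i j b yij irreflpD[OF irr]
    by (auto simp: matrix_unit_annihilating matrix_unit_zero_iff theta_closed)
qed

end

theorem corollary2p14:
  fixes n :: nat
    and M :: "nat \<Rightarrow> nat \<Rightarrow> 'a ring"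
    and \<theta> :: "nat \<Rightarrow> nat \<Rightarrow> nat \<Rightarrow> 'a \<Rightarrow> 'a \<Rightarrow> 'a"
    and R :: "(nat \<times> nat \<Rightarrow> 'a) ring"
    and S :: "(nat \<times> nat \<Rightarrow> 'a) set"
    and y :: "nat \<times> nat \<Rightarrow> 'a"
  assumes "generalized_matrix_ring n M \<theta>"
    and "n > 1"
    and "R = gm_ring n M \<theta>"
    and "S = lower_annihilating n M \<theta> \<or> S = upper_annihilating n M \<theta>"
    and "subring S R"
    and "strongly_pi_regular (R\<lparr>carrier := diag_matrices n M \<theta>\<rparr>)"
    and "y \<in> carrier R"
    and "y \<noteq> \<zero>\<^bsub>R\<^esub>"
  shows "(y \<in> S \<and>
      (\<exists>p::nat. p > 0 \<and>
        y [^]\<^bsub>R\<^esub> p \<in> y [^]\<^bsub>R\<^esub> (p + 1) <#\<^bsub>R\<^esub> S \<and>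
        y [^]\<^bsub>R\<^esub> (p + 1) <#\<^bsub>R\<^esub> S \<subseteq> y [^]\<^bsub>R\<^esub> (p + 1) <#\<^bsub>R\<^esub> carrier R)) \<or>
    (y \<notin> S \<and>
      (\<exists>s \<in> S. \<exists>v \<in> S. \<exists>i \<in> {1..n}. \<exists>j \<in> {1..n}. \<exists>(k::nat) (m::nat).
        diag_unit n M i \<in> S \<and> diag_unit n M j \<in> S \<and> k > 0 \<and> m > 0 \<and>
        (let a = s \<otimes>\<^bsub>R\<^esub> y \<otimes>\<^bsub>R\<^esub> diag_unit n M j;
             b = diag_unit n M i \<otimes>\<^bsub>R\<^esub> y \<otimes>\<^bsub>R\<^esub> v
         in (a \<noteq> \<zero>\<^bsub>R\<^esub> \<and> a \<in> S \<and>
               a [^]\<^bsub>R\<^esub> m \<in> a [^]\<^bsub>R\<^esub> (m + 1) <#\<^bsub>R\<^esub> S \<and>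
               a [^]\<^bsub>R\<^esub> (m + 1) <#\<^bsub>R\<^esub> S \<subseteq> a [^]\<^bsub>R\<^esub> (m + 1) <#\<^bsub>R\<^esub> carrier R) \<or>
            (b \<noteq> \<zero>\<^bsub>R\<^esub> \<and> b \<in> S \<and>
               b [^]\<^bsub>R\<^esub> k \<in> b [^]\<^bsub>R\<^esub> (k + 1) <#\<^bsub>R\<^esub> S \<and>
               b [^]\<^bsub>R\<^esub> (k + 1) <#\<^bsub>R\<^esub> S \<subseteq> b [^]\<^bsub>R\<^esub> (k + 1) <#\<^bsub>R\<^esub> carrier R))))"
proof -
  interpret generalized_matrix_ring n M \<theta> by (rule assms(1))
  note R = assms(3)
  obtain P where SP: "S = annihilating P" and tot: "totalp P"
    and asym: "asymp P"
  proof (cases "S = lower_annihilating n M \<theta>")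
    case True
    then show ?thesis using that[of "\<lambda>i j. i > j"] by (simp add: lower_annihilating_eq)
  next
    case False
    then show ?thesis using that[of "\<lambda>i j. i < j"] assms(4) by (simp add: upper_annihilating_eq)
  qed
  have irr: "irreflp P"
    using asym by (rule irreflp_on_if_asymp_on)
  have reg: "\<exists>p::nat. p > 0 \<and> x [^]\<^bsub>R\<^esub> p \<in> x [^]\<^bsub>R\<^esub> (p + 1) <#\<^bsub>R\<^esub> S" if "x \<in> S" for x
    unfolding R SP
  proof (rule annihilating_strongly_pi_regular[OF _ tot irr])
    show "n > 0" using assms(2) by (rule less_trans[OF zero_less_one])
    show "subring (annihilating P) GM" using assms(5) unfolding R SP .
    show "strongly_pi_regular (GM\<lparr>carrier := diag_matrices n M \<theta>\<rparr>)" using assms(6) unfolding R .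
    show "x \<in> annihilating P" using that unfolding SP .
  qed
  have incl: "x <#\<^bsub>R\<^esub> S \<subseteq> x <#\<^bsub>R\<^esub> carrier R" for x
    using subringE(1)[OF assms(5)] unfolding l_coset_def by (rule UN_mono) simp
  have unit: "diag_unit n M i \<in> S" if "i \<in> {1..n}" for i
    unfolding SP diag_unit_eq
    by (rule matrix_unit_annihilating[OF irreflpD[OF irr] that that entry_one_closed[OF that]])
  show ?thesis
  proof (cases "y \<in> S")
    case True
    from reg[OF True] obtain p :: nat
      where "p > 0" "y [^]\<^bsub>R\<^esub> p \<in> y [^]\<^bsub>R\<^esub> (p + 1) <#\<^bsub>R\<^esub> S"
      by (elim exE conjE) (rule that)
    then show ?thesis
      using True incl by (intro disjI1 conjI exI[of _ p])
  next
    case False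
    obtain i j s where ij: "i \<in> {1..n}" "j \<in> {1..n}" and s: "s \<in> S"
      and corner: "s \<otimes>\<^bsub>R\<^esub> y \<otimes>\<^bsub>R\<^esub> diag_unit n M j \<in> S \<and> s \<otimes>\<^bsub>R\<^esub> y \<otimes>\<^bsub>R\<^esub> diag_unit n M j \<noteq> \<zero>\<^bsub>R\<^esub> \<or>
        diag_unit n M i \<otimes>\<^bsub>R\<^esub> y \<otimes>\<^bsub>R\<^esub> s \<in> S \<and> diag_unit n M i \<otimes>\<^bsub>R\<^esub> y \<otimes>\<^bsub>R\<^esub> s \<noteq> \<zero>\<^bsub>R\<^esub>"
      using non_annihilating_diagonal_corner[OF asym assms(7)[unfolded R] False[unfolded SP]]
      unfolding R SP .
    define good where "good p x \<longleftrightarrow> x \<noteq> \<zero>\<^bsub>R\<^esub> \<and> x \<in> S \<and>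
        x [^]\<^bsub>R\<^esub> p \<in> x [^]\<^bsub>R\<^esub> (p + 1) <#\<^bsub>R\<^esub> S \<and>
        x [^]\<^bsub>R\<^esub> (p + 1) <#\<^bsub>R\<^esub> S \<subseteq> x [^]\<^bsub>R\<^esub> (p + 1) <#\<^bsub>R\<^esub> carrier R"
      for p :: nat and x
    have "\<exists>p>0. good p x" if "x \<in> S \<and> x \<noteq> \<zero>\<^bsub>R\<^esub>" for x
      using that reg[of x] incl unfolding good_def by simp
    with corner obtain p :: nat where p: "p > 0"
      and good: "good p (s \<otimes>\<^bsub>R\<^esub> y \<otimes>\<^bsub>R\<^esub> diag_unit n M j) \<or>
        good p (diag_unit n M i \<otimes>\<^bsub>R\<^esub> y \<otimes>\<^bsub>R\<^esub> s)"
      by blast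
    \<comment> \<open>The same \<open>s\<close> and the same \<open>p\<close> serve both alternatives.\<close>
    show ?thesis
      unfolding Let_def
      by (rule disjI2, rule conjI[OF False], rule bexI[OF _ s], rule bexI[OF _ s],
          rule bexI[OF _ ij(1)], rule bexI[OF _ ij(2)], rule exI[of _ p], rule exI[of _ p],
          intro conjI unit ij p good[unfolded good_def])
  qed
qed

end
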